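(* Let $\sigma>0$, let $n\geq 2$ be an integer, let $p\in(0,1)$ and $\alpha\in(0,1)$, and let $Z_1,\dots,Z_n$ be independent random variables, each with the normal distribution of mean $0$ and standard deviation $\sigma$ (the law of $Z$). Let $s$ be the number of significant digits of $Z$ with probability $p$, i.e. the largest real number such that $\mathbb{P}(|Z|<2^{-s})\geq p$. Let $\hat\sigma_Z$ be the empirical standard deviation of $Z_1,\dots,Z_n$ and set $$\hat{s}_{\mathrm{cnh}}=-\log_2\left(\hat\sigma_Z\right)-\left[\frac12\log_2\left(\frac{n-1}{\chi^2_{1-\alpha/2}}\right)+\log_2\left(F^{-1}\left(\frac{p+1}{2}\right)\right)\right].$$ Then $\hat{s}_{\mathrm{cnh}}$ is a lower bound of $s$ with confidence level $1-\alpha$, that is, $$\mathbb{P}\left(\hat{s}_{\mathrm{cnh}}\leq s\right)\geq 1-\alpha .$$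
   Context: $F$ is the cumulative distribution function of the normal distribution with mean $0$ and variance $1$. The empirical standard deviation is $\hat\sigma_Z=\sqrt{\frac{1}{n-1}\sum_{i=1}^n (Z_i-\bar Z)^2}$ with $\bar Z=\frac1n\sum_{i=1}^n Z_i$. For $q\in(0,1)$, $\chi^2_{q}$ denotes the real number such that a $\chi^2$ random variable with $n-1$ degrees of freedom exceeds $\chi^2_q$ with probability $q$ (upper-tail convention, so $\chi^2_{1-\alpha/2}$ is the quantile of order $\alpha/2$). *)

theory Defs
  imports "HOL-Probability.Probability"
begin

text \<open>Sums of squares of \<open>k\<close> independent standard normal variables.\<close>
definition chi_square_distribution :: "nat \<Rightarrow> real measure" where
  "chi_square_distribution k =
     distr (\<Pi>\<^sub>M i\<in>{..<k}. std_normal_distribution) borel (\<lambda>x. \<Sum>i<k. (x i)\<^sup>2)"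

text \<open>Upper-tail convention: the value exceeded with probability \<open>q\<close>.\<close>
definition chi_square_upper :: "nat \<Rightarrow> real \<Rightarrow> real" where
  "chi_square_upper k q = (THE x. measure (chi_square_distribution k) {x<..} = q)"

definition emp_mean :: "nat \<Rightarrow> (nat \<Rightarrow> real) \<Rightarrow> real" where
  "emp_mean n z = 1 / real n * (\<Sum>i=1..n. z i)"

definition emp_sd :: "nat \<Rightarrow> (nat \<Rightarrow> real) \<Rightarrow> real" where
  "emp_sd n z = sqrt (1 / (real n - 1) * (\<Sum>i=1..n. (z i - emp_mean n z)\<^sup>2))"

definition sig_digits :: "'a measure \<Rightarrow> ('a \<Rightarrow> real) \<Rightarrow> real \<Rightarrow> real" where
  "sig_digits M Z p =
     (GREATEST s::real. measure M {\<omega> \<in> space M. \<bar>Z \<omega>\<bar> < 2 powr (- s)} \<ge> p)"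

text \<open>
  \<open>F\<inverse>\<close> is \<open>inv\<close> of the standard normal cdf; it is only evaluated at \<open>(p + 1) / 2\<close>, which for
  \<open>0 < p < 1\<close> lies in the range \<open>{0<..<1}\<close> of that injective function. If all samples coincide
  (a null event), \<open>log 2 0 = 0\<close>.
\<close>
definition s_cnh :: "nat \<Rightarrow> real \<Rightarrow> real \<Rightarrow> (nat \<Rightarrow> real) \<Rightarrow> real" where
  "s_cnh n p \<alpha> z =
     - log 2 (emp_sd n z)
     - (1 / 2 * log 2 ((real n - 1) / chi_square_upper (n - 1) (1 - \<alpha> / 2))
        + log 2 (inv (cdf std_normal_distribution) ((p + 1) / 2)))"

end

theory Submission
  imports Defs
begin

text \<open>
  Let \<open>G\<close> be the standard normal quantile of order \<open>(p + 1) / 2\<close>. By symmetry of the normal law,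
  \<open>s = - log 2 (\<sigma> * G)\<close> (lemma \<open>sig_digits_normal\<close>), so the quantile terms cancel in the
  comparison of the estimator with \<open>s\<close>, and it is enough that the sum of squared deviations, divided by
  \<open>\<sigma>\<^sup>2\<close>, exceeds the chi-square quantile (lemma \<open>s_cnh_le\<close>). This sum has the chi-square distribution with
  \<open>n - 1\<close> degrees of freedom (lemma \<open>sum_sq_dev_chi_square\<close>), so the bound holds with probability at least
  \<open>1 - \<alpha> / 2\<close>, the upper-tail probability at that quantile (lemma \<open>chi_square_upper\<close>).
  This is at least \<open>1 - \<alpha>\<close>: a one-sided bound uses one of the two tails of a two-sided interval.

  The substantial ingredient is the chi-square law of the sum of squared deviations. It is proved by
  induction on the sample size (lemma \<open>nn_integral_helmert\<close>). The induction carries the joint law of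
  the sum of squared deviations and the normalised sum \<open>(\<Sum>i. x i) / sqrt n\<close>. Adding an observation
  rotates the pair formed by the normalised sum and that observation: one rotated coordinate is the new
  normalised sum, the square of the other is the increase of the sum of squared deviations. Since
  a pair of independent standard normals is invariant under rotations (lemma \<open>gaussian_rotation\<close>), each
  step contributes one more independent standard normal square.
\<close>

section \<open>Rotation invariance\<close>

text \<open>
  The joint density of two independent standard normals is radial, hence unchanged by a rotation.
  The change of variables is carried out one coordinate at a time: first \<open>x = (u - s * y) / c\<close> for
  fixed \<open>y\<close>, then \<open>y = c * v + s * u\<close> for fixed \<open>u\<close>. The two Jacobians \<open>1 / c\<close> and \<open>c\<close> cancel;
  dividing by \<open>c\<close> is why \<open>0 < c\<close> is assumed.
\<close>
lemma gaussian_rotation: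
  fixes f :: "real \<times> real \<Rightarrow> ennreal"
  assumes [measurable]: "f \<in> borel_measurable (borel \<Otimes>\<^sub>M borel)"
    and c: "0 < c" and cs: "c\<^sup>2 + s\<^sup>2 = 1"
  shows "(\<integral>\<^sup>+y. \<integral>\<^sup>+x. f (c * x + s * y, c * y - s * x) \<partial>std_normal_distribution \<partial>std_normal_distribution)
       = (\<integral>\<^sup>+u. \<integral>\<^sup>+v. f (u, v) \<partial>std_normal_distribution \<partial>std_normal_distribution)"
proof -
  let ?\<phi> = "\<lambda>x y. ennreal (std_normal_density x) * ennreal (std_normal_density y)"
  have phi_meas [measurable]: "(\<lambda>x. ennreal (std_normal_density x)) \<in> borel_measurable borel"
    by measurable
  have radial: "?\<phi> (c * u - s * v) (c * v + s * u) = ?\<phi> u v" for u v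
  proof -
    have "(c * u - s * v)\<^sup>2 + (c * v + s * u)\<^sup>2 = (c\<^sup>2 + s\<^sup>2) * (u\<^sup>2 + v\<^sup>2)"
      by (simp add: power2_eq_square algebra_simps)
    then have *: "- (c * u - s * v)\<^sup>2 / 2 + - (c * v + s * u)\<^sup>2 / 2 = - u\<^sup>2 / 2 + - v\<^sup>2 / 2"
      using cs by (simp add: field_simps)
    have "exp (- (c * u - s * v)\<^sup>2 / 2) * exp (- (c * v + s * u)\<^sup>2 / 2)
        = exp (- u\<^sup>2 / 2) * exp (- v\<^sup>2 / 2)"
      unfolding exp_add[symmetric] * ..
    then show ?thesis
      by (simp add: std_normal_density_def ennreal_mult[symmetric] field_simps)
  qed
  have density2: "(\<integral>\<^sup>+y. \<integral>\<^sup>+x. g x y \<partial>std_normal_distribution \<partial>std_normal_distribution)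
      = (\<integral>\<^sup>+y. \<integral>\<^sup>+x. ?\<phi> x y * g x y \<partial>lborel \<partial>lborel)"
    if [measurable]: "case_prod g \<in> borel_measurable (borel \<Otimes>\<^sub>M borel)" for g
    by (simp add: nn_integral_density nn_integral_cmult[symmetric] mult_ac)
  have "(\<integral>\<^sup>+y. \<integral>\<^sup>+x. f (c * x + s * y, c * y - s * x) \<partial>std_normal_distribution \<partial>std_normal_distribution)
      = (\<integral>\<^sup>+y. \<integral>\<^sup>+x. ?\<phi> x y * f (c * x + s * y, c * y - s * x) \<partial>lborel \<partial>lborel)"
    by (rule density2) measurable
  also have "\<dots> = (\<integral>\<^sup>+y. ennreal (1 / c) * (\<integral>\<^sup>+u. ?\<phi> ((u - s * y) / c) y * f (u, (y - s * u) / c) \<partial>lborel) \<partial>lborel)"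
  proof (rule nn_integral_cong)
    fix y :: real
    have eq3: "- (s * y / c) + 1 / c * u = (u - s * y) / c" for u
      by (simp add: diff_divide_distrib)
    have eq1: "c * ((u - s * y) / c) + s * y = u" for u
      using c by simp
    have eq2: "c * y - s * ((u - s * y) / c) = (y - s * u) / c" for u
    proof -
      have "c * y - s * ((u - s * y) / c) = ((c\<^sup>2 + s\<^sup>2) * y - s * u) / c"
        using c by (simp add: field_simps power2_eq_square)
      then show ?thesis using cs by simp
    qed
    show "(\<integral>\<^sup>+x. ?\<phi> x y * f (c * x + s * y, c * y - s * x) \<partial>lborel)
      = ennreal (1 / c) * (\<integral>\<^sup>+u. ?\<phi> ((u - s * y) / c) y * f (u, (y - s * u) / c) \<partial>lborel)"
      using c by (subst nn_integral_real_affine[where c = "1 / c" and t = "- (s * y / c)"])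
        (measurable, simp_all only: eq3, simp_all only: eq1 eq2, simp_all)
  qed
  also have "\<dots> = ennreal (1 / c) * (\<integral>\<^sup>+u. \<integral>\<^sup>+y. ?\<phi> ((u - s * y) / c) y * f (u, (y - s * u) / c) \<partial>lborel \<partial>lborel)"
    by (subst nn_integral_cmult, measurable, subst lborel_pair.Fubini', measurable)
  also have "\<dots> = ennreal (1 / c) * (\<integral>\<^sup>+u. ennreal c * (\<integral>\<^sup>+v. ?\<phi> u v * f (u, v) \<partial>lborel) \<partial>lborel)"
  proof (intro arg_cong[where f = "\<lambda>a. ennreal (1 / c) * a"] nn_integral_cong)
    fix u :: real
    have *: "(u - s * (s * u + c * v)) / c = c * u - s * v" "(s * u + c * v - s * u) / c = v"
        "s * u + c * v = c * v + s * u" for v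
    proof -
      have "u - s * (s * u) = (1 - s\<^sup>2) * u" by (simp add: power2_eq_square algebra_simps)
      also have "1 - s\<^sup>2 = c\<^sup>2" using cs by simp
      finally have "u - s * (s * u + c * v) = c * (c * u - s * v)"
        by (simp add: power2_eq_square algebra_simps)
      then show "(u - s * (s * u + c * v)) / c = c * u - s * v"
        using c by simp
    qed (use c in auto)
    show "(\<integral>\<^sup>+y. ?\<phi> ((u - s * y) / c) y * f (u, (y - s * u) / c) \<partial>lborel)
      = ennreal c * (\<integral>\<^sup>+v. ?\<phi> u v * f (u, v) \<partial>lborel)"
      using c by (subst nn_integral_real_affine[where c = c and t = "s * u"])
        (measurable, simp_all only: *(1,2), simp_all only: *(3) radial, simp_all)
  qed
  also have "\<dots> = (\<integral>\<^sup>+u. \<integral>\<^sup>+v. ?\<phi> u v * f (u, v) \<partial>lborel \<partial>lborel)"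
    using c by (simp add: nn_integral_cmult mult.assoc[symmetric] ennreal_mult[symmetric])
  also have "\<dots> = (\<integral>\<^sup>+u. \<integral>\<^sup>+v. f (u, v) \<partial>std_normal_distribution \<partial>std_normal_distribution)"
    by (subst density2) (simp_all add: mult_ac)
  finally show ?thesis .
qed

section \<open>The sum of squared deviations of a normal sample\<close>
definition sum_sq_dev :: "nat \<Rightarrow> (nat \<Rightarrow> real) \<Rightarrow> real" where
  "sum_sq_dev n z = (\<Sum>i=1..n. (z i - emp_mean n z)\<^sup>2)"

lemma sum_sq_dev_eq:
  assumes "n > 0"
  shows "sum_sq_dev n z = (\<Sum>i=1..n. (z i)\<^sup>2) - (\<Sum>i=1..n. z i)\<^sup>2 / real n"
proof -
  let ?S = "\<Sum>i=1..n. z i"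
  have "sum_sq_dev n z = (\<Sum>i=1..n. (z i)\<^sup>2 - 2 * (?S / real n) * z i + (?S / real n)\<^sup>2)"
    unfolding sum_sq_dev_def emp_mean_def by (intro sum.cong) (auto simp: power2_eq_square algebra_simps)
  also have "\<dots> = (\<Sum>i=1..n. (z i)\<^sup>2) - 2 * (?S / real n) * ?S + real n * (?S / real n)\<^sup>2"
    by (simp add: sum.distrib sum_subtractf sum_distrib_left)
  also have "\<dots> = (\<Sum>i=1..n. (z i)\<^sup>2) - ?S\<^sup>2 / real n"
    using assms by (simp add: power2_eq_square field_simps)
  finally show ?thesis .
qed

lemma sum_sq_dev_measurable:
  assumes "\<And>i. i \<in> {1..n} \<Longrightarrow> (\<lambda>\<omega>. X \<omega> i) \<in> borel_measurable M"
  shows "(\<lambda>\<omega>. sum_sq_dev n (X \<omega>)) \<in> borel_measurable M"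
  unfolding sum_sq_dev_def emp_mean_def
  by (intro borel_measurable_sum borel_measurable_power borel_measurable_diff borel_measurable_times
      borel_measurable_const assms)

lemma sum_sq_dev_scale: "sum_sq_dev n (\<lambda>i. a * z i) = a\<^sup>2 * sum_sq_dev n z"
proof -
  have "emp_mean n (\<lambda>i. a * z i) = a * emp_mean n z"
    by (simp add: emp_mean_def sum_distrib_left[symmetric])
  then show ?thesis
    by (simp add: sum_sq_dev_def sum_distrib_left power_mult_distrib flip: right_diff_distrib)
qed

text \<open>
  Adding an observation increases the sum of squared deviations by the square of
  \<open>c * z (Suc n) - s * U\<close>, where \<open>U\<close> is the normalised partial sum, \<open>c\<^sup>2 = n / Suc n\<close> and
  \<open>s\<^sup>2 = 1 / Suc n\<close>. As \<open>c\<^sup>2 + s\<^sup>2 = 1\<close>, the increment is the square of one coordinate of a rotation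
  of \<open>(z (Suc n), U)\<close>; the other coordinate is the next normalised partial sum.
\<close>
lemma sum_sq_dev_Suc:
  assumes "n > 0"
  shows "sum_sq_dev (Suc n) z = sum_sq_dev n z
    + (sqrt (n / Suc n) * z (Suc n) - 1 / sqrt (Suc n) * ((\<Sum>i=1..n. z i) / sqrt n))\<^sup>2"
proof -
  define a where "a = sqrt (real n)"
  define b where "b = sqrt (real (Suc n))"
  have ab: "a > 0" "b > 0" "a\<^sup>2 = real n" "b\<^sup>2 = real n + 1"
    using assms by (auto simp: a_def b_def)
  let ?S = "\<Sum>i=1..n. z i"
  let ?y = "z (Suc n)"
  have S: "(\<Sum>i=1..Suc n. z i) = ?S + ?y" "(\<Sum>i=1..Suc n. (z i)\<^sup>2) = (\<Sum>i=1..n. (z i)\<^sup>2) + ?y\<^sup>2"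
    by (simp_all add: sum.cl_ivl_Suc)
  have b2: "b\<^sup>2 = a\<^sup>2 + 1" using ab by simp
  have "?y\<^sup>2 - (?S + ?y)\<^sup>2 / b\<^sup>2 = - ?S\<^sup>2 / a\<^sup>2 + (a / b * ?y - 1 / b * (?S / a))\<^sup>2"
  proof -
    have "(a / b * ?y - 1 / b * (?S / a))\<^sup>2 = (a\<^sup>2 * ?y - ?S)\<^sup>2 / (a\<^sup>2 * b\<^sup>2)"
      using ab(1,2) by (simp add: power2_eq_square field_simps)
    moreover have "a\<^sup>2 * b\<^sup>2 * ?y\<^sup>2 - a\<^sup>2 * (?S + ?y)\<^sup>2 = - b\<^sup>2 * ?S\<^sup>2 + (a\<^sup>2 * ?y - ?S)\<^sup>2"
      unfolding b2 by (simp add: power2_eq_square algebra_simps)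
    then have "(a\<^sup>2 * b\<^sup>2 * ?y\<^sup>2 - a\<^sup>2 * (?S + ?y)\<^sup>2) / (a\<^sup>2 * b\<^sup>2)
       = (- b\<^sup>2 * ?S\<^sup>2 + (a\<^sup>2 * ?y - ?S)\<^sup>2) / (a\<^sup>2 * b\<^sup>2)" by simp
    then have "?y\<^sup>2 - (?S + ?y)\<^sup>2 / b\<^sup>2 = - ?S\<^sup>2 / a\<^sup>2 + (a\<^sup>2 * ?y - ?S)\<^sup>2 / (a\<^sup>2 * b\<^sup>2)"
      using ab(1,2) by (simp add: diff_divide_distrib add_divide_distrib)
    ultimately show ?thesis by simp
  qed
  moreover have "sqrt (n / Suc n) = a / b"
    by (simp add: a_def b_def real_sqrt_divide)
  moreover have "sum_sq_dev (Suc n) z = (\<Sum>i=1..n. (z i)\<^sup>2) + ?y\<^sup>2 - (?S + ?y)\<^sup>2 / b\<^sup>2"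
    unfolding sum_sq_dev_eq[OF zero_less_Suc] S by (simp add: b_def)
  moreover have "sum_sq_dev n z = (\<Sum>i=1..n. (z i)\<^sup>2) - ?S\<^sup>2 / a\<^sup>2"
    unfolding sum_sq_dev_eq[OF assms] by (simp add: a_def)
  ultimately show ?thesis
    unfolding a_def[symmetric] b_def[symmetric] by simp
qed

text \<open>
  For an iid standard normal sample, the sum of squared deviations and the normalised sum are
  independent, the first being distributed like a sum of \<open>m\<close> squares, the second standard normal.
  Including the normalised sum in the statement is what makes the induction go through: the next
  step rotates it together with the new observation, and independence from the squares collected so
  far is part of the hypothesis. This is Helmert's orthogonal transformation, one plane rotation at a
  time. The joint law is expressed by integrals of test functions, so that the step is a
  computation with iterated integrals.
\<close>
lemma nn_integral_helmert:
  fixes f :: "real \<times> real \<Rightarrow> ennreal"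
  assumes "f \<in> borel_measurable (borel \<Otimes>\<^sub>M borel)"
  shows "(\<integral>\<^sup>+x. f (sum_sq_dev (Suc m) x, (\<Sum>i=1..Suc m. x i) / sqrt (Suc m))
             \<partial>(\<Pi>\<^sub>M i\<in>{1..Suc m}. std_normal_distribution))
       = (\<integral>\<^sup>+x. \<integral>\<^sup>+u. f (\<Sum>i<m. (x i)\<^sup>2, u) \<partial>std_normal_distribution
             \<partial>(\<Pi>\<^sub>M i\<in>{..<m}. std_normal_distribution))"
  using assms
proof (induction m arbitrary: f)
  interpret N: real_distribution std_normal_distribution by (rule real_dist_normal_dist)
  interpret P: product_sigma_finite "\<lambda>_::nat. std_normal_distribution" ..
  {
    case 0
    note [measurable] = 0
    have "(\<integral>\<^sup>+x. f (sum_sq_dev (Suc 0) x, (\<Sum>i=1..Suc 0. x i) / sqrt (Suc 0)) \<partial>(\<Pi>\<^sub>M i\<in>{1..Suc 0}. std_normal_distribution))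
      = (\<integral>\<^sup>+x. f (0, x 1) \<partial>(\<Pi>\<^sub>M i\<in>{1::nat}. std_normal_distribution))"
      by (simp add: sum_sq_dev_def emp_mean_def)
    also have "\<dots> = (\<integral>\<^sup>+u. f (0, u) \<partial>std_normal_distribution)"
      by (rule P.product_nn_integral_singleton) simp
    finally show ?case
      by (simp add: P.nn_integral_empty del: nn_integral_const)
  next
    case (Suc m)
    note [measurable] = Suc.prems
    define n where "n = Suc m"
    define c where "c = sqrt (n / Suc n)"
    define s where "s = 1 / sqrt (Suc n)"
    have c: "c > 0" by (simp add: c_def n_def)
    have cs: "c\<^sup>2 + s\<^sup>2 = 1"
      by (simp add: c_def s_def power_divide flip: add_divide_distrib)
    have n0: "n > 0" by (simp add: n_def)
    \<comment> \<open>The integral over the new observation, as a function of the statistics of the first \<open>n\<close>;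
      the induction hypothesis applies to it.\<close>
    define g where "g = (\<lambda>(t, u). \<integral>\<^sup>+y. f (t + (c * y - s * u)\<^sup>2, c * u + s * y) \<partial>std_normal_distribution)"
    have g_meas [measurable]: "g \<in> borel_measurable (borel \<Otimes>\<^sub>M borel)"
      unfolding g_def by measurable
    have sum_meas [measurable]: "(\<lambda>x. \<Sum>i=1..Suc n. x i) \<in> borel_measurable (\<Pi>\<^sub>M i\<in>{1..Suc n}. std_normal_distribution)"
      by (intro borel_measurable_sum measurable_component_singleton[THEN measurable_compose]) auto
    have dev_meas [measurable]: "sum_sq_dev (Suc n) \<in> borel_measurable (\<Pi>\<^sub>M i\<in>{1..Suc n}. std_normal_distribution)"
      by (intro sum_sq_dev_measurable measurable_component_singleton[THEN measurable_compose]) auto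
    have upd: "(\<Sum>i=1..Suc n. (x(Suc n := y)) i) / sqrt (Suc n)
           = c * ((\<Sum>i=1..n. x i) / sqrt n) + s * y"
         "sum_sq_dev (Suc n) (x(Suc n := y)) = sum_sq_dev n x + (c * y - s * ((\<Sum>i=1..n. x i) / sqrt n))\<^sup>2" for x y
    proof -
      have same: "(\<Sum>i=1..n. (x(Suc n := y)) i) = (\<Sum>i=1..n. x i)"
           "sum_sq_dev n (x(Suc n := y)) = sum_sq_dev n x"
        by (auto simp: sum_sq_dev_def emp_mean_def)
      show "(\<Sum>i=1..Suc n. (x(Suc n := y)) i) / sqrt (Suc n)
           = c * ((\<Sum>i=1..n. x i) / sqrt n) + s * y"
        using n0 by (simp add: same sum.cl_ivl_Suc c_def s_def real_sqrt_divide field_simps)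
      show "sum_sq_dev (Suc n) (x(Suc n := y)) = sum_sq_dev n x + (c * y - s * ((\<Sum>i=1..n. x i) / sqrt n))\<^sup>2"
        unfolding sum_sq_dev_Suc[OF n0] same by (simp add: c_def s_def)
    qed
    have ins: "{1..Suc n} = insert (Suc n) {1..n}" by auto
    have "(\<integral>\<^sup>+x. f (sum_sq_dev (Suc n) x, (\<Sum>i=1..Suc n. x i) / sqrt (Suc n)) \<partial>(\<Pi>\<^sub>M i\<in>{1..Suc n}. std_normal_distribution))
      = (\<integral>\<^sup>+x. \<integral>\<^sup>+y. f (sum_sq_dev (Suc n) (x(Suc n := y)), (\<Sum>i=1..Suc n. (x(Suc n := y)) i) / sqrt (Suc n))
           \<partial>std_normal_distribution \<partial>(\<Pi>\<^sub>M i\<in>{1..n}. std_normal_distribution))"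
      unfolding ins by (rule P.product_nn_integral_insert) (simp, simp, fold ins, measurable)
    also have "\<dots> = (\<integral>\<^sup>+x. g (sum_sq_dev n x, (\<Sum>i=1..n. x i) / sqrt n) \<partial>(\<Pi>\<^sub>M i\<in>{1..n}. std_normal_distribution))"
      unfolding upd g_def by simp
    also have "\<dots> = (\<integral>\<^sup>+x. \<integral>\<^sup>+u. g (\<Sum>i<m. (x i)\<^sup>2, u) \<partial>std_normal_distribution
             \<partial>(\<Pi>\<^sub>M i\<in>{..<m}. std_normal_distribution))"
      unfolding n_def by (rule Suc.IH) measurable
    also have "\<dots> = (\<integral>\<^sup>+x. \<integral>\<^sup>+w. \<integral>\<^sup>+u. f ((\<Sum>i<m. (x i)\<^sup>2) + w\<^sup>2, u) \<partial>std_normal_distribution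
           \<partial>std_normal_distribution \<partial>(\<Pi>\<^sub>M i\<in>{..<m}. std_normal_distribution))"
    proof (rule nn_integral_cong)
      fix x :: "nat \<Rightarrow> real"
      define t where "t = (\<Sum>i<m. (x i)\<^sup>2)"
      \<comment> \<open>The new observation is the inner variable and yields the square, hence the angle with sine \<open>- s\<close>.\<close>
      have "(\<integral>\<^sup>+u. \<integral>\<^sup>+y. (\<lambda>(w, v). f (t + w\<^sup>2, v)) (c * y + (- s) * u, c * u - (- s) * y)
              \<partial>std_normal_distribution \<partial>std_normal_distribution)
          = (\<integral>\<^sup>+w. \<integral>\<^sup>+u. (\<lambda>(w, v). f (t + w\<^sup>2, v)) (w, u) \<partial>std_normal_distribution \<partial>std_normal_distribution)"
        using c cs by (intro gaussian_rotation) auto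
      then show "(\<integral>\<^sup>+u. g (t, u) \<partial>std_normal_distribution)
        = (\<integral>\<^sup>+w. \<integral>\<^sup>+u. f (t + w\<^sup>2, u) \<partial>std_normal_distribution \<partial>std_normal_distribution)"
        by (simp add: g_def)
    qed
    also have "\<dots> = (\<integral>\<^sup>+x. \<integral>\<^sup>+u. f (\<Sum>i<Suc m. (x i)\<^sup>2, u) \<partial>std_normal_distribution
             \<partial>(\<Pi>\<^sub>M i\<in>{..<Suc m}. std_normal_distribution))"
      unfolding lessThan_Suc by (subst P.product_nn_integral_insert) (auto simp: add.commute)
    finally show ?case by (simp only: n_def)
  }
qed

lemma sum_squares_measurable:
  "(\<lambda>x. \<Sum>i<k. (x i)\<^sup>2) \<in> borel_measurable (\<Pi>\<^sub>M i\<in>{..<k}. std_normal_distribution)"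
  by (intro borel_measurable_sum borel_measurable_power measurable_component_singleton[THEN measurable_compose]) auto

text \<open>
  The first marginal of the joint law computed above, applied to the standardised sample
  \<open>X i / \<sigma>\<close>; the scale leaves the sum of squared deviations as the factor \<open>\<sigma>\<^sup>2\<close>.
\<close>
lemma (in prob_space) sum_sq_dev_chi_square:
  assumes n: "n > 0" and \<sigma>: "\<sigma> > 0"
    and indep: "indep_vars (\<lambda>_. borel) X {1..n}"
    and normal: "\<And>i. i \<in> {1..n} \<Longrightarrow> distributed M lborel (X i) (normal_density 0 \<sigma>)"
  shows "distr M borel (\<lambda>\<omega>. sum_sq_dev n (\<lambda>i. X i \<omega>) / \<sigma>\<^sup>2) = chi_square_distribution (n - 1)"
proof -
  interpret N: real_distribution std_normal_distribution by (rule real_dist_normal_dist)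
  define Y where "Y = (\<lambda>i \<omega>. X i \<omega> / \<sigma>)"
  define Yv where "Yv = (\<lambda>\<omega>. \<lambda>i\<in>{1..n}. Y i \<omega>)"
  have indepY: "indep_vars (\<lambda>_. borel) Y {1..n}"
    unfolding Y_def by (rule indep_vars_compose2[OF indep]) simp
  have distrY: "distr M borel (Y i) = std_normal_distribution" if "i \<in> {1..n}" for i
  proof -
    have "distributed M lborel (\<lambda>\<omega>. (X i \<omega> - 0) / \<sigma>) std_normal_density"
      using normal[OF that] normal_standard_normal_convert[OF \<sigma>, of "X i" 0] by simp
    then have "distr M lborel (Y i) = std_normal_distribution"
      unfolding Y_def by (auto dest: distributed_distr_eq_density)
    moreover have "distr M lborel (Y i) = distr M borel (Y i)"
      by (rule distr_cong) auto
    ultimately show ?thesis by simp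
  qed
  have Y_meas: "Y i \<in> borel_measurable M" if "i \<in> {1..n}" for i
    using indepY that by (auto simp: indep_vars_def)
  have Yv_meas: "Yv \<in> measurable M (\<Pi>\<^sub>M i\<in>{1..n}. borel)"
    unfolding Yv_def by (intro measurable_restrict Y_meas)
  have distrYv: "distr M (\<Pi>\<^sub>M i\<in>{1..n}. borel) Yv = (\<Pi>\<^sub>M i\<in>{1..n}. std_normal_distribution)"
  proof -
    have "distr M (\<Pi>\<^sub>M i\<in>{1..n}. borel) Yv = (\<Pi>\<^sub>M i\<in>{1..n}. distr M borel (Y i))"
      unfolding Yv_def using n indepY Y_meas by (intro indep_vars_iff_distr_eq_PiM'[THEN iffD1]) auto
    also have "\<dots> = (\<Pi>\<^sub>M i\<in>{1..n}. std_normal_distribution)"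
      by (rule PiM_cong) (auto simp: distrY)
    finally show ?thesis .
  qed
  have dev_meas: "sum_sq_dev n \<in> borel_measurable (\<Pi>\<^sub>M i\<in>{1..n}. borel)"
    by (intro sum_sq_dev_measurable measurable_component_singleton[THEN measurable_compose]) auto
  have dev_Yv: "sum_sq_dev n (\<lambda>i. X i \<omega>) / \<sigma>\<^sup>2 = sum_sq_dev n (Yv \<omega>)" for \<omega>
  proof -
    have "sum_sq_dev n (Yv \<omega>) = sum_sq_dev n (\<lambda>i. Y i \<omega>)"
      by (simp add: sum_sq_dev_def emp_mean_def Yv_def)
    also have "\<dots> = (1 / \<sigma>)\<^sup>2 * sum_sq_dev n (\<lambda>i. X i \<omega>)"
      by (subst sum_sq_dev_scale[symmetric]) (simp add: Y_def)
    finally show ?thesis by (simp add: power_divide)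
  qed
  have "distr M borel (\<lambda>\<omega>. sum_sq_dev n (\<lambda>i. X i \<omega>) / \<sigma>\<^sup>2)
      = distr (\<Pi>\<^sub>M i\<in>{1..n}. std_normal_distribution) borel (sum_sq_dev n)"
    unfolding distrYv[symmetric] dev_Yv by (subst distr_distr[OF dev_meas Yv_meas]) (simp add: comp_def)
  also have "\<dots> = chi_square_distribution (n - 1)"
  proof (rule measure_eqI)
    fix A assume "A \<in> sets (distr (\<Pi>\<^sub>M i\<in>{1..n}. std_normal_distribution) borel (sum_sq_dev n))"
    then have A [measurable]: "A \<in> sets borel" by simp
    obtain m where m: "n = Suc m" using n by (cases n) auto
    have sets_eq: "sets (\<Pi>\<^sub>M i\<in>I. std_normal_distribution) = sets (\<Pi>\<^sub>M i\<in>I. borel)" for I :: "nat set"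
      by (rule sets_PiM_cong) auto
    have dev_meas': "sum_sq_dev n \<in> borel_measurable (\<Pi>\<^sub>M i\<in>{1..n}. std_normal_distribution)"
      using dev_meas by (simp cong: measurable_cong_sets add: measurable_cong_sets[OF sets_eq refl])
    have "emeasure (distr (\<Pi>\<^sub>M i\<in>{1..n}. std_normal_distribution) borel (sum_sq_dev n)) A
        = (\<integral>\<^sup>+x. indicator A (sum_sq_dev n x) \<partial>(\<Pi>\<^sub>M i\<in>{1..n}. std_normal_distribution))"
      by (subst nn_integral_indicator[symmetric], simp, subst nn_integral_distr[OF dev_meas']) auto
    also have "\<dots> = (\<integral>\<^sup>+x. \<integral>\<^sup>+u. indicator A (\<Sum>i<m. (x i)\<^sup>2) \<partial>std_normal_distribution
             \<partial>(\<Pi>\<^sub>M i\<in>{..<m}. std_normal_distribution))"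
      unfolding m using nn_integral_helmert[of "\<lambda>(t, u). indicator A t" m] by simp
    also have "\<dots> = (\<integral>\<^sup>+x. indicator A (\<Sum>i<m. (x i)\<^sup>2) \<partial>(\<Pi>\<^sub>M i\<in>{..<m}. std_normal_distribution))"
      using N.emeasure_space_1 by simp
    also have "\<dots> = emeasure (chi_square_distribution (n - 1)) A"
      unfolding chi_square_distribution_def m
      by (subst nn_integral_indicator[symmetric], simp, subst nn_integral_distr) (use sum_squares_measurable in auto)
    finally show "emeasure (distr (\<Pi>\<^sub>M i\<in>{1..n}. std_normal_distribution) borel (sum_sq_dev n)) A
        = emeasure (chi_square_distribution (n - 1)) A" .
  qed (simp add: chi_square_distribution_def)
  finally show ?thesis .
qed

section \<open>Quantiles of the normal and chi-square distributions\<close>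

lemma (in real_distribution) atomless_cdf_surj:
  assumes atomless: "\<And>x. measure M {x} = 0" and r: "0 < r" "r < 1"
  shows "\<exists>x. cdf M x = r"
proof -
  have "eventually (\<lambda>x. cdf M x < r) at_bot"
    using cdf_lim_at_bot r by (auto dest: order_tendstoD)
  then obtain a where a: "\<And>x. x \<le> a \<Longrightarrow> cdf M x < r"
    unfolding eventually_at_bot_linorder by auto
  have "eventually (\<lambda>x. cdf M x > r) at_top"
    using cdf_lim_at_top_prob r by (auto dest: order_tendstoD)
  then obtain b where b: "\<And>x. x \<ge> b \<Longrightarrow> cdf M x > r"
    unfolding eventually_at_top_linorder by auto
  have "a \<le> b" using a[of "min a b"] b[of "max a b"] a[of a] b[of a] by (meson le_cases less_asym order_refl)
  then show ?thesis
    using IVT[of "cdf M" a r b] a[of a] b[of b] atomless isCont_cdf by (auto simp: less_imp_le)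
qed

lemma std_normal_finite_null:
  assumes "finite A"
  shows "emeasure std_normal_distribution A = 0"
proof -
  have "A \<in> null_sets lborel"
    using assms by (rule finite_imp_null_set_lborel)
  then have "A \<in> null_sets std_normal_distribution"
    by (intro absolutely_continuousI_density[unfolded absolutely_continuous_def, THEN subsetD]) auto
  then show ?thesis by auto
qed

lemma std_normal_interval_pos:
  assumes "a < b"
  shows "measure std_normal_distribution {a<..<b} > 0"
proof -
  interpret N: real_distribution std_normal_distribution by (rule real_dist_normal_dist)
  have "emeasure std_normal_distribution {a<..<b} \<noteq> 0"
  proof
    assume "emeasure std_normal_distribution {a<..<b} = 0"
    then have "{a<..<b} \<in> null_sets std_normal_distribution" by auto
    then have "AE x in lborel. x \<in> {a<..<b} \<longrightarrow> ennreal (std_normal_density x) = 0"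
      by (simp add: null_sets_density_iff)
    then have "AE x in lborel. x \<notin> {a<..<b}"
    proof eventually_elim
      case (elim x)
      then show ?case
        using normal_density_pos[of 1 0 x] by (auto simp: ennreal_eq_0_iff)
    qed
    then have "{a<..<b} \<in> null_sets lborel"
      by (subst AE_iff_null_sets) auto
    then show False using assms by (simp add: null_sets_def)
  qed
  then show ?thesis
    by (simp add: N.emeasure_eq_measure zero_less_measure_iff)
qed

lemma real_distribution_chi_square: "real_distribution (chi_square_distribution k)"
proof -
  interpret N: real_distribution std_normal_distribution by (rule real_dist_normal_dist)
  interpret P: prob_space "\<Pi>\<^sub>M i\<in>{..<k}. std_normal_distribution"
    by (intro prob_space_PiM) (rule N.prob_space_axioms)
  show ?thesis
    unfolding chi_square_distribution_def
    by (intro P.real_distribution_distr sum_squares_measurable)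
qed

lemma emeasure_chi_square:
  assumes "A \<in> sets borel"
  shows "emeasure (chi_square_distribution k) A
       = emeasure (\<Pi>\<^sub>M i\<in>{..<k}. std_normal_distribution)
           {x \<in> space (\<Pi>\<^sub>M i\<in>{..<k}. std_normal_distribution). (\<Sum>i<k. (x i)\<^sup>2) \<in> A}"
  unfolding chi_square_distribution_def
  by (subst emeasure_distr[OF sum_squares_measurable assms]) (auto intro!: arg_cong2[where f = emeasure])

text \<open>
  If each of the \<open>k\<close> coordinates has its square in \<open>(a / k, b / k)\<close>, the sum of squares lies in
  \<open>(a, b)\<close>; this box already has positive probability.
\<close>
lemma chi_square_interval_pos:
  assumes k: "k > 0" and ab: "0 \<le> a" "a < b"
  shows "measure (chi_square_distribution k) {a<..<b} > 0"
proof -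
  interpret C: real_distribution "chi_square_distribution k" by (rule real_distribution_chi_square)
  interpret N: real_distribution std_normal_distribution by (rule real_dist_normal_dist)
  interpret P: product_sigma_finite "\<lambda>_::nat. std_normal_distribution" ..
  let ?P = "\<Pi>\<^sub>M i\<in>{..<k}. std_normal_distribution"
  define J where "J = {sqrt (a / k)<..<sqrt (b / k)}"
  have "0 < emeasure std_normal_distribution J"
    using std_normal_interval_pos[of "sqrt (a / k)" "sqrt (b / k)"] k ab
    by (simp add: J_def N.emeasure_eq_measure divide_strict_right_mono)
  then have "emeasure std_normal_distribution J \<noteq> 0" by auto
  then have "(\<Prod>i<k. emeasure std_normal_distribution J) \<noteq> 0" by simp
  then have "0 < (\<Prod>i<k. emeasure std_normal_distribution J)"
    by (rule zero_less_iff_neq_zero[THEN iffD2])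
  also have "\<dots> = emeasure ?P (\<Pi>\<^sub>E i\<in>{..<k}. J)"
    by (rule P.emeasure_PiM[symmetric]) (auto simp: J_def)
  also have "\<dots> \<le> emeasure ?P {x \<in> space ?P. (\<Sum>i<k. (x i)\<^sup>2) \<in> {a<..<b}}"
  proof (rule emeasure_mono)
    show "{x \<in> space ?P. (\<Sum>i<k. (x i)\<^sup>2) \<in> {a<..<b}} \<in> sets ?P"
      by (rule measurable_sets_Collect[OF sum_squares_measurable]) auto
    show "(\<Pi>\<^sub>E i\<in>{..<k}. J) \<subseteq> {x \<in> space ?P. (\<Sum>i<k. (x i)\<^sup>2) \<in> {a<..<b}}"
    proof safe
      fix x assume x: "x \<in> (\<Pi>\<^sub>E i\<in>{..<k}. J)"
      then show "x \<in> space ?P" by (auto simp: space_PiM PiE_def)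
      have sq: "a / k < (x i)\<^sup>2 \<and> (x i)\<^sup>2 < b / k" if "i < k" for i
      proof -
        have "x i \<in> J" using x that by (auto simp: PiE_def Pi_def)
        then have l: "sqrt (a / k) < x i" and u: "x i < sqrt (b / k)" by (auto simp: J_def)
        have nn: "0 \<le> sqrt (a / k)" using ab by simp
        have "(sqrt (a / k))\<^sup>2 < (x i)\<^sup>2" "(x i)\<^sup>2 < (sqrt (b / k))\<^sup>2"
          by (rule power_strict_mono; use l u nn in linarith | simp)+
        then show ?thesis using ab by simp
      qed
      have "(\<Sum>i<k. a / k) < (\<Sum>i<k. (x i)\<^sup>2)" "(\<Sum>i<k. (x i)\<^sup>2) < (\<Sum>i<k. b / k)"
        by (rule sum_strict_mono; use sq k in auto)+
      then show "(\<Sum>i<k. (x i)\<^sup>2) \<in> {a<..<b}" using k by simp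
    qed
  qed
  also have "\<dots> = emeasure (chi_square_distribution k) {a<..<b}"
    by (rule emeasure_chi_square[symmetric]) simp
  finally show ?thesis
    by (simp add: C.emeasure_eq_measure)
qed

text \<open>
  Given all coordinates but one, at most two values of the remaining one produce the sum \<open>t\<close>.
\<close>
lemma chi_square_atomless:
  assumes "k > 0"
  shows "measure (chi_square_distribution k) {t} = 0"
proof -
  interpret N: real_distribution std_normal_distribution by (rule real_dist_normal_dist)
  interpret P: product_sigma_finite "\<lambda>_::nat. std_normal_distribution" ..
  obtain m where m: "k = Suc m" using assms by (cases k) auto
  have meas: "(\<lambda>x. indicator {t} (\<Sum>i<Suc m. (x i)\<^sup>2) :: ennreal)
      \<in> borel_measurable (\<Pi>\<^sub>M i\<in>{..<Suc m}. std_normal_distribution)"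
    by (rule measurable_compose[OF sum_squares_measurable]) simp
  have inner: "(\<integral>\<^sup>+y. indicator {t} (r + y\<^sup>2) \<partial>std_normal_distribution) = 0" for r
  proof -
    have "\<bar>y\<bar> = sqrt (t - r)" if "r + y\<^sup>2 = t" for y
      using that by (simp flip: real_sqrt_abs)
    then have "{y. r + y\<^sup>2 = t} \<subseteq> {sqrt (t - r), - sqrt (t - r)}"
      by (smt (verit) insertCI mem_Collect_eq subsetI)
    then have fin: "finite {y. r + y\<^sup>2 = t}" by (rule finite_subset) simp
    have "(\<integral>\<^sup>+y. indicator {t} (r + y\<^sup>2) \<partial>std_normal_distribution)
        = (\<integral>\<^sup>+y. indicator {y. r + y\<^sup>2 = t} y \<partial>std_normal_distribution)"
      by (intro nn_integral_cong) (auto simp: indicator_def)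
    also have "\<dots> = emeasure std_normal_distribution {y. r + y\<^sup>2 = t}"
      using fin by (intro nn_integral_indicator) (simp add: finite_imp_closed borel_closed)
    finally show ?thesis using std_normal_finite_null[OF fin] by simp
  qed
  have "emeasure (chi_square_distribution k) {t}
      = (\<integral>\<^sup>+x. indicator {t} (\<Sum>i<Suc m. (x i)\<^sup>2) \<partial>(\<Pi>\<^sub>M i\<in>{..<Suc m}. std_normal_distribution))"
    unfolding chi_square_distribution_def m
    by (subst nn_integral_indicator[symmetric], simp, subst nn_integral_distr[OF sum_squares_measurable]) auto
  also have "\<dots> = (\<integral>\<^sup>+x. \<integral>\<^sup>+y. indicator {t} ((\<Sum>i<m. (x i)\<^sup>2) + y\<^sup>2) \<partial>std_normal_distribution
      \<partial>(\<Pi>\<^sub>M i\<in>{..<m}. std_normal_distribution))"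
    using meas unfolding lessThan_Suc by (subst P.product_nn_integral_insert) (auto simp: add.commute)
  also have "\<dots> = 0" by (simp add: inner)
  finally show ?thesis by (simp add: measure_def)
qed

text \<open>
  The definite description is meaningful because the upper tail is continuous (no atoms) and strictly
  decreasing on the positive half-line (positive mass on intervals). As the tail equals \<open>1\<close>
  at every point \<open>\<le> 0\<close>, the restriction \<open>q < 1\<close> forces the quantile to be positive.
\<close>
lemma chi_square_upper:
  assumes k: "k > 0" and q: "0 < q" "q < 1"
  shows "measure (chi_square_distribution k) {chi_square_upper k q<..} = q"
    and "chi_square_upper k q > 0"
proof -
  let ?C = "chi_square_distribution k"
  interpret C: real_distribution ?C by (rule real_distribution_chi_square)
  have tail: "measure ?C {x<..} = 1 - cdf ?C x" for x
  proof -
    have "measure ?C (UNIV - {..x}) = 1 - cdf ?C x"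
      using C.prob_compl[of "{..x}"] by (simp add: cdf_def)
    moreover have "UNIV - {..x} = {x<..}" by auto
    ultimately show ?thesis by simp
  qed
  have "emeasure ?C {..<0} = 0"
  proof -
    have "{x \<in> space (\<Pi>\<^sub>M i\<in>{..<k}. std_normal_distribution). (\<Sum>i<k. (x i)\<^sup>2) \<in> {..<0}} = {}"
      by (auto simp: not_less intro: sum_nonneg)
    then have "emeasure ?C {..<0} = emeasure (\<Pi>\<^sub>M i\<in>{..<k}. std_normal_distribution) {}"
      by (subst emeasure_chi_square) (simp, rule arg_cong2[where f = emeasure], auto)
    then show ?thesis by simp
  qed
  then have "measure ?C {..<0} = 0" by (simp add: measure_def)
  moreover have "measure ?C {..0} = measure ?C {..<0} + measure ?C {0}"
    unfolding ivl_disj_un(2)[symmetric] by (subst C.finite_measure_Union) auto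
  ultimately have cdf0: "cdf ?C 0 = 0"
    using chi_square_atomless[OF k, of 0] by (simp add: cdf_def)
  have pos: "x > 0" if "measure ?C {x<..} = q" for x
  proof (rule ccontr)
    assume "\<not> x > 0"
    then have "cdf ?C x \<le> 0" using C.cdf_nondecreasing[of x 0] cdf0 by simp
    then show False using that q tail[of x] by simp
  qed
  have neq: "measure ?C {x<..} \<noteq> measure ?C {y<..}" if "0 < x" "x < y" for x y
  proof -
    have "0 < measure ?C {x<..<y}" using chi_square_interval_pos[OF k, of x y] that by simp
    also have "\<dots> \<le> measure ?C {x<..y}" by (rule C.finite_measure_mono) auto
    also have "\<dots> = cdf ?C y - cdf ?C x" using C.cdf_diff_eq[OF \<open>x < y\<close>] by simp
    finally show ?thesis by (simp add: tail)
  qed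
  obtain x where "cdf ?C x = 1 - q"
    using C.atomless_cdf_surj[of "1 - q"] chi_square_atomless[OF k] q by auto
  then have x: "measure ?C {x<..} = q" by (simp add: tail)
  have "chi_square_upper k q = x"
    unfolding chi_square_upper_def
  proof (rule the_equality)
    fix y assume y: "measure ?C {y<..} = q"
    show "y = x"
      using neq[of x y] neq[of y x] pos[OF x] pos[OF y] x y by (cases x y rule: linorder_cases) auto
  qed (rule x)
  with x pos[OF x] show "measure ?C {chi_square_upper k q<..} = q" "chi_square_upper k q > 0" by auto
qed

lemma std_normal_cdf_strict_mono: "strict_mono (cdf std_normal_distribution)"
proof (rule strict_monoI)
  interpret N: real_distribution std_normal_distribution by (rule real_dist_normal_dist)
  fix x y :: real
  assume "x < y"
  have "0 < measure std_normal_distribution {x<..<y}"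
    by (rule std_normal_interval_pos) fact
  also have "\<dots> \<le> measure std_normal_distribution {x<..y}"
    by (rule N.finite_measure_mono) auto
  also have "\<dots> = cdf std_normal_distribution y - cdf std_normal_distribution x"
    using N.cdf_diff_eq[OF \<open>x < y\<close>] by simp
  finally show "cdf std_normal_distribution x < cdf std_normal_distribution y" by simp
qed

lemma std_normal_cdf_uminus: "cdf std_normal_distribution (- t) = 1 - cdf std_normal_distribution t"
proof -
  interpret N: real_distribution std_normal_distribution by (rule real_dist_normal_dist)
  have "emeasure std_normal_distribution {..-t}
      = (\<integral>\<^sup>+x. ennreal (std_normal_density x) * indicator {..-t} x \<partial>lborel)"
    by (rule emeasure_density) auto
  also have "\<dots> = (\<integral>\<^sup>+x. ennreal (std_normal_density (- x)) * indicator {..-t} (- x) \<partial>lborel)"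
    by (subst nn_integral_real_affine[where c = "-1" and t = 0]) auto
  also have "\<dots> = (\<integral>\<^sup>+x. ennreal (std_normal_density x) * indicator {t..} x \<partial>lborel)"
    by (intro nn_integral_cong) (auto simp: std_normal_density_def split: split_indicator)
  also have "\<dots> = emeasure std_normal_distribution {t..}"
    by (rule emeasure_density[symmetric]) auto
  finally have "measure std_normal_distribution {..-t} = measure std_normal_distribution {t..}"
    by (simp add: measure_def)
  also have "{t..} = {t} \<union> (UNIV - {..t})" by auto
  also have "measure std_normal_distribution ({t} \<union> (UNIV - {..t}))
      = measure std_normal_distribution {t} + measure std_normal_distribution (UNIV - {..t})"
    by (rule N.finite_measure_Union) auto
  also have "measure std_normal_distribution {t} = 0"
    using std_normal_finite_null[of "{t}"] by (simp add: measure_def)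
  also have "measure std_normal_distribution (UNIV - {..t}) = 1 - measure std_normal_distribution {..t}"
    using N.prob_compl[of "{..t}"] by simp
  finally show ?thesis by (simp add: cdf_def)
qed

section \<open>Significant digits and the confidence bound\<close>

lemma (in prob_space) normal_prob_abs_less:
  assumes \<sigma>: "\<sigma> > 0" and Z: "distributed M lborel Z (normal_density 0 \<sigma>)" and t: "t > 0"
  shows "prob {\<omega> \<in> space M. \<bar>Z \<omega>\<bar> < t} = 2 * cdf std_normal_distribution (t / \<sigma>) - 1"
proof -
  interpret N: real_distribution std_normal_distribution by (rule real_dist_normal_dist)
  let ?F = "cdf std_normal_distribution"
  have std: "distributed M lborel (\<lambda>\<omega>. (Z \<omega> - 0) / \<sigma>) std_normal_density"
    using Z normal_standard_normal_convert[OF \<sigma>, of Z 0] by simp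
  then have distr: "distr M lborel (\<lambda>\<omega>. Z \<omega> / \<sigma>) = std_normal_distribution"
    by (auto dest: distributed_distr_eq_density)
  have meas: "(\<lambda>\<omega>. Z \<omega> / \<sigma>) \<in> measurable M lborel"
    using distributed_measurable[OF std] by simp
  have tpos: "t / \<sigma> > 0" using t \<sigma> by simp
  have "{\<omega> \<in> space M. \<bar>Z \<omega>\<bar> < t} = (\<lambda>\<omega>. Z \<omega> / \<sigma>) -` {- (t / \<sigma>)<..<t / \<sigma>} \<inter> space M"
    using \<sigma> by (auto simp: abs_less_iff field_simps)
  then have "prob {\<omega> \<in> space M. \<bar>Z \<omega>\<bar> < t} = measure std_normal_distribution {- (t / \<sigma>)<..<t / \<sigma>}"
    unfolding distr[symmetric] by (subst measure_distr[OF meas]) auto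
  also have "\<dots> = measure std_normal_distribution {- (t / \<sigma>)<..t / \<sigma>}"
  proof -
    have "{- (t / \<sigma>)<..t / \<sigma>} = {- (t / \<sigma>)<..<t / \<sigma>} \<union> {t / \<sigma>}"
      using tpos by auto
    then have "measure std_normal_distribution {- (t / \<sigma>)<..t / \<sigma>}
       = measure std_normal_distribution {- (t / \<sigma>)<..<t / \<sigma>} + measure std_normal_distribution {t / \<sigma>}"
      by (simp only:) (rule N.finite_measure_Union, auto)
    then show ?thesis
      using std_normal_finite_null[of "{t / \<sigma>}"] by (simp add: measure_def)
  qed
  also have "\<dots> = ?F (t / \<sigma>) - ?F (- (t / \<sigma>))"
    using N.cdf_diff_eq[of "- (t / \<sigma>)" "t / \<sigma>"] tpos by simp
  also have "\<dots> = 2 * ?F (t / \<sigma>) - 1"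
    by (simp add: std_normal_cdf_uminus)
  finally show ?thesis .
qed

lemma std_normal_quantile:
  assumes p: "0 < p" "p < 1"
  defines "G \<equiv> inv (cdf std_normal_distribution) ((p + 1) / 2)"
  shows "cdf std_normal_distribution G = (p + 1) / 2" and "G > 0"
proof -
  interpret N: real_distribution std_normal_distribution by (rule real_dist_normal_dist)
  obtain x where "cdf std_normal_distribution x = (p + 1) / 2"
    using N.atomless_cdf_surj[of "(p + 1) / 2"] p std_normal_finite_null
    by (auto simp: measure_def)
  then show G: "cdf std_normal_distribution G = (p + 1) / 2"
    unfolding G_def by (intro f_inv_into_f) (metis rangeI)
  have "cdf std_normal_distribution 0 = 1 / 2"
    using std_normal_cdf_uminus[of 0] by simp
  then have "cdf std_normal_distribution 0 < cdf std_normal_distribution G"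
    using G p by simp
  then show "G > 0"
    using strict_mono_less[OF std_normal_cdf_strict_mono] by blast
qed

text \<open>
  The event \<open>\<bar>Z\<bar> < 2 powr - s\<close> has probability at least \<open>p\<close> exactly when \<open>\<sigma> * G \<le> 2 powr - s\<close>,
  with \<open>G\<close> the normal quantile of order \<open>(p + 1) / 2\<close>, so the set of admissible \<open>s\<close> is a closed
  half-line and its greatest element exists.
\<close>
lemma sig_digits_normal:
  assumes N: "prob_space N" and \<sigma>: "\<sigma> > 0" and p: "0 < p" "p < 1"
    and Z: "distributed N lborel Z (normal_density 0 \<sigma>)"
  shows "sig_digits N Z p = - log 2 (\<sigma> * inv (cdf std_normal_distribution) ((p + 1) / 2))"
proof -
  define G where "G = inv (cdf std_normal_distribution) ((p + 1) / 2)"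
  have G: "cdf std_normal_distribution G = (p + 1) / 2" "G > 0"
    using std_normal_quantile[OF p] by (simp_all add: G_def)
  have iff: "p \<le> measure N {\<omega> \<in> space N. \<bar>Z \<omega>\<bar> < 2 powr - s} \<longleftrightarrow> s \<le> - log 2 (\<sigma> * G)" for s
  proof -
    have "p \<le> measure N {\<omega> \<in> space N. \<bar>Z \<omega>\<bar> < 2 powr - s}
        \<longleftrightarrow> cdf std_normal_distribution G \<le> cdf std_normal_distribution (2 powr - s / \<sigma>)"
      by (subst prob_space.normal_prob_abs_less[OF N \<sigma> Z]) (auto simp: G(1) field_simps)
    also have "\<dots> \<longleftrightarrow> \<sigma> * G \<le> 2 powr - s"
      using \<sigma> by (simp add: strict_mono_less_eq[OF std_normal_cdf_strict_mono] field_simps)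
    also have "\<dots> \<longleftrightarrow> s \<le> - log 2 (\<sigma> * G)"
      using \<sigma> G by (subst log_le_iff[symmetric]) auto
    finally show ?thesis .
  qed
  show ?thesis
    unfolding sig_digits_def G_def[symmetric] iff by (rule Greatest_equality) auto
qed

text \<open>
  The normal quantile occurs with the same sign on both sides and cancels; what remains is
  \<open>\<sigma>\<^sup>2 \<le> (n - 1) * (emp_sd n z)\<^sup>2 / c\<close> in logarithmic form, where \<open>c\<close> is the chi-square quantile.
  The hypothesis excludes \<open>emp_sd n z = 0\<close>, where the logarithm would take its default value, since
  \<open>c\<close> is positive.
\<close>
lemma s_cnh_le:
  assumes n: "n \<ge> 2" and \<sigma>: "\<sigma> > 0" and p: "0 < p" "p < 1" and \<alpha>: "0 < \<alpha>" "\<alpha> < 1"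
    and dev: "chi_square_upper (n - 1) (1 - \<alpha> / 2) < sum_sq_dev n z / \<sigma>\<^sup>2"
  shows "s_cnh n p \<alpha> z \<le> - log 2 (\<sigma> * inv (cdf std_normal_distribution) ((p + 1) / 2))"
proof -
  define G where "G = inv (cdf std_normal_distribution) ((p + 1) / 2)"
  define c where "c = chi_square_upper (n - 1) (1 - \<alpha> / 2)"
  have G: "G > 0" using std_normal_quantile[OF p] by (simp add: G_def)
  have c: "c > 0" unfolding c_def using n \<alpha> by (intro chi_square_upper) auto
  have n1: "real n - 1 > 0" using n by simp
  have le: "\<sigma>\<^sup>2 \<le> sum_sq_dev n z / c" and D: "sum_sq_dev n z > 0"
  proof -
    have "c * \<sigma>\<^sup>2 < sum_sq_dev n z"
      using dev \<sigma> by (simp add: c_def field_simps)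
    moreover have "0 < c * \<sigma>\<^sup>2" using c \<sigma> by simp
    ultimately show "\<sigma>\<^sup>2 \<le> sum_sq_dev n z / c" "sum_sq_dev n z > 0"
      using c by (auto simp: field_simps)
  qed
  have sd: "emp_sd n z = sqrt (sum_sq_dev n z / (real n - 1))"
    by (simp add: emp_sd_def sum_sq_dev_def)
  have "2 * log 2 (emp_sd n z) + log 2 ((real n - 1) / c)
      = log 2 (sum_sq_dev n z / (real n - 1)) + log 2 ((real n - 1) / c)"
    using D n1 by (simp add: sd log_root sqrt_def flip: log_nat_power)
  also have "\<dots> = log 2 (sum_sq_dev n z / c)"
    using D n1 c by (simp add: log_divide)
  also have "\<dots> \<ge> log 2 (\<sigma>\<^sup>2)"
    using le \<sigma> D c by simp
  also have "log 2 (\<sigma>\<^sup>2) = 2 * log 2 \<sigma>"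
    using \<sigma> by (simp add: log_nat_power)
  finally show ?thesis
    using \<sigma> G unfolding s_cnh_def G_def[symmetric] c_def[symmetric] by (simp add: log_mult)
qed

theorem mainTheorem3:
  fixes M :: "'a measure" and N :: "'b measure"
    and Z :: "'b \<Rightarrow> real" and Zs :: "nat \<Rightarrow> 'a \<Rightarrow> real"
    and \<sigma> p \<alpha> :: real and n :: nat
  assumes "\<sigma> > 0" and "n \<ge> 2"
    and "0 < p" and "p < 1" and "0 < \<alpha>" and "\<alpha> < 1"
    and "prob_space N" and "distributed N lborel Z (normal_density 0 \<sigma>)"
    and "prob_space M"
    and "prob_space.indep_vars M (\<lambda>_. borel) Zs {1..n}"
    and "\<And>i. i \<in> {1..n} \<Longrightarrow> distributed M lborel (Zs i) (normal_density 0 \<sigma>)"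
  shows "measure M {\<omega> \<in> space M. s_cnh n p \<alpha> (\<lambda>i. Zs i \<omega>) \<le> sig_digits N Z p} \<ge> 1 - \<alpha>"
proof -
  interpret M: prob_space M by fact
  define c where "c = chi_square_upper (n - 1) (1 - \<alpha> / 2)"
  define V where "V = (\<lambda>\<omega>. sum_sq_dev n (\<lambda>i. Zs i \<omega>) / \<sigma>\<^sup>2)"
  have dev_meas [measurable]: "(\<lambda>\<omega>. sum_sq_dev n (\<lambda>i. Zs i \<omega>)) \<in> borel_measurable M"
    using assms(11)[THEN distributed_measurable] by (intro sum_sq_dev_measurable) simp
  have V_meas [measurable]: "V \<in> borel_measurable M"
    unfolding V_def by measurable
  have sd_meas [measurable]: "(\<lambda>\<omega>. s_cnh n p \<alpha> (\<lambda>i. Zs i \<omega>)) \<in> borel_measurable M"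
    unfolding s_cnh_def emp_sd_def sum_sq_dev_def[symmetric] by measurable
  have V_distr: "distr M borel V = chi_square_distribution (n - 1)"
    unfolding V_def using assms(1,2,10,11) by (intro M.sum_sq_dev_chi_square) auto
  have "1 - \<alpha> \<le> 1 - \<alpha> / 2" using assms(5) by simp
  also have "\<dots> = measure (chi_square_distribution (n - 1)) {c<..}"
    unfolding c_def using assms(2,5,6) by (intro chi_square_upper(1)[symmetric]) auto
  also have "\<dots> = measure M {\<omega> \<in> space M. c < V \<omega>}"
    unfolding V_distr[symmetric] by (subst measure_distr) (auto intro!: arg_cong2[where f = measure])
  also have "\<dots> \<le> measure M {\<omega> \<in> space M. s_cnh n p \<alpha> (\<lambda>i. Zs i \<omega>) \<le> sig_digits N Z p}"
    unfolding sig_digits_normal[OF assms(7,1,3,4,8)]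
  proof (rule M.finite_measure_mono)
    show "{\<omega> \<in> space M. c < V \<omega>} \<subseteq> {\<omega> \<in> space M. s_cnh n p \<alpha> (\<lambda>i. Zs i \<omega>)
        \<le> - log 2 (\<sigma> * inv (cdf std_normal_distribution) ((p + 1) / 2))}"
      using s_cnh_le[OF assms(2,1,3,4,5,6)] by (auto simp: c_def V_def)
  qed measurable
  finally show ?thesis .
qed

end
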